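(* Let $m\ge1$ and let $C\subseteq\mathbb{F}_2^N$ be a self-dual binary linear code. (i) The real Clifford group $\mathcal{C}_m$, acting diagonally on $(\mathbb{R}^{2^m})^{\otimes N}$ (i.e. $g$ acts as $g^{\otimes N}$), fixes the full weight enumerator $\mathrm{fwe}(C(m))$. (ii) $\mathcal{C}_m$ fixes the complete weight enumerator $\mathrm{cwe}(C(m))$.
   Context: Let $\sigma_1=\begin{pmatrix}0&1\\1&0\end{pmatrix}$, $\sigma_2=\begin{pmatrix}1&0\\0&-1\end{pmatrix}$, $E(1)=\langle\sigma_1,\sigma_2\rangle$, $E(m)\le O(2^m,\mathbb{R})$ the group of all $A_1\otimes\cdots\otimes A_m$ with $A_i\in E(1)$, and $\mathcal{C}_m$ the normalizer of $E(m)$ in $O(2^m,\mathbb{R})$. Index the standard basis of $\mathbb{R}^{2^m}=(\mathbb{R}^2)^{\otimes m}$ by $v\in\mathbb{F}_2^{\,m}$ via $b_{(v_1,\dots,v_m)}=y_{v_1}\otimes\cdots\otimes y_{v_m}$. Fix an $\mathbb{F}_2$-basis $a_1,\dots,a_m$ of $\mathbb{F}_{2^m}$ and identify $f=\sum\varepsilon_ia_i$ with $(\varepsilon_1,\dots,\varepsilon_m)$, writing $x_f$ for the basis vector $b_{(\varepsilon_1,\dots,\varepsilon_m)}$. For $C\subseteq\mathbb{F}_2^N$ let $C(m)=C\otimes_{\mathbb{F}_2}\mathbb{F}_{2^m}\subseteq\mathbb{F}_{2^m}^N$. The full weight enumerator is $\mathrm{fwe}(C(m))=\sum_{c=(c_1,\dots,c_N)\in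 C(m)}x_{c_1}\otimes\cdots\otimes x_{c_N}\in(\mathbb{R}^{2^m})^{\otimes N}$. The complete weight enumerator is the polynomial $\mathrm{cwe}(C(m))=\sum_{c\in C(m)}\prod_{f}x_f^{a_f(c)}$ ($a_f(c)$ = number of coordinates of $c$ equal to $f$), on which $g\in GL(2^m,\mathbb{R})$ acts by linear substitution $(g\cdot p)(x)=p(g^{-1}x)$. *)

theory Defs
  imports "HOL-Analysis.Analysis" "HOL-Algebra.Generated_Groups" "HOL-Algebra.Group_Action"
    "HOL-Library.Z2" "HOL-Library.Poly_Mapping" "HOL-Computational_Algebra.Primes"
begin

instance bit :: finite
proof
  have "(UNIV :: bit set) \<subseteq> {0, 1}" by auto
  then show "finite (UNIV :: bit set)" by (rule finite_subset) simp
qed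

section \<open>Tensor powers\<close>

text \<open>
  For \<open>V = \<real>^'a\<close> the tensor power of \<open>V\<close> over the index type \<open>'i\<close> is \<open>\<real>^('a^'i)\<close>:
  the basis vector indexed by \<open>w\<close> is the tensor product of the \<open>e_{w_i}\<close>.
  With \<open>'a = bit\<close> and \<open>'i = 'm\<close> this is the \<open>m\<close>-fold tensor power of \<open>\<real>^2\<close>, where the
  basis of \<open>\<real>^2\<close> is indexed by the field with two elements.
\<close>

definition tensor_vec :: "('i::finite \<Rightarrow> real^'a) \<Rightarrow> real^('a^'i)" where
  "tensor_vec x = (\<chi> w. \<Prod>i\<in>UNIV. x i $ (w $ i))"

definition tensor_mat :: "('i::finite \<Rightarrow> real^'a^'a) \<Rightarrow> real^('a^'i)^('a^'i)" where
  "tensor_mat A = (\<chi> v w. \<Prod>i\<in>UNIV. A i $ (v $ i) $ (w $ i))"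

section \<open>The real Clifford group\<close>

definition orthogonal_grp :: "(real^'a^'a) monoid" where
  "orthogonal_grp = \<lparr>carrier = {A. orthogonal_matrix A}, monoid.mult = (**), one = mat 1\<rparr>"

definition sigma1 :: "real^bit^bit" where
  "sigma1 = (\<chi> i j. if i = j then 0 else 1)"

definition sigma2 :: "real^bit^bit" where
  "sigma2 = (\<chi> i j. if i = j then (if i = 0 then 1 else -1) else 0)"

definition E1 :: "(real^bit^bit) set" where
  "E1 = generate orthogonal_grp {sigma1, sigma2}"

definition Em :: "(real^(bit^'m::finite)^(bit^'m)) set" where
  "Em = {tensor_mat A | A. \<forall>i. A i \<in> E1}"

definition real_clifford_group :: "(real^(bit^'m::finite)^(bit^'m)) set" where
  "real_clifford_group = normalizer orthogonal_grp Em"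

section \<open>Bases of the field with \<open>2^m\<close> elements over the field with two elements\<close>

text \<open>
  The map \<open>of_bit\<close> sends 0 to 0 and 1 to 1; on fields of characteristic 2 it is the
  inclusion of the prime field, and \<open>F2_scale\<close> makes such a field a vector space over \<open>bit\<close>.
\<close>

definition F2_scale :: "bit \<Rightarrow> 'k::field \<Rightarrow> 'k" where
  "F2_scale b x = of_bit b * x"

definition F2_basis :: "('m::finite \<Rightarrow> 'k::field) \<Rightarrow> bool" where
  "F2_basis a \<longleftrightarrow> inj a \<and> \<not> module.dependent F2_scale (a ` UNIV) \<and>
     module.span F2_scale (a ` UNIV) = UNIV"

definition coords :: "('m::finite \<Rightarrow> 'k::field) \<Rightarrow> 'k \<Rightarrow> bit^'m" where
  "coords a f = (THE \<epsilon>. f = (\<Sum>i\<in>UNIV. F2_scale (\<epsilon> $ i) (a i)))"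

definition basis_vec :: "bit^'m::finite \<Rightarrow> real^(bit^'m)" where
  "basis_vec v = tensor_vec (\<lambda>i. axis (v $ i) 1)"

section \<open>Codes and the full weight enumerator\<close>

definition dual_code :: "(bit^'n::finite) set \<Rightarrow> (bit^'n) set" where
  "dual_code C = {v. \<forall>c\<in>C. (\<Sum>i\<in>UNIV. v $ i * c $ i) = 0}"

definition self_dual_code :: "(bit^'n::finite) set \<Rightarrow> bool" where
  "self_dual_code C \<longleftrightarrow> vec.subspace C \<and> dual_code C = C"

text \<open>The extension of scalars \<open>C(m)\<close>, as a subspace of \<open>'k^'n\<close>.\<close>

definition ext_code :: "(bit^'n::finite) set \<Rightarrow> ('k::field^'n) set" where
  "ext_code C = vec.span ((\<lambda>c. \<chi> i. of_bit (c $ i)) ` C)"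

definition fwe :: "('m::finite \<Rightarrow> 'k::field) \<Rightarrow> (bit^'n::finite) set \<Rightarrow> real^((bit^'m)^'n)" where
  "fwe a C = (\<Sum>c\<in>ext_code C. tensor_vec (\<lambda>i. basis_vec (coords a (c $ i))))"

section \<open>Polynomials and the complete weight enumerator\<close>

text \<open>
  Real polynomials in variables indexed by \<open>'v\<close>; the exponent vector of a monomial is an
  element of \<open>'v \<Rightarrow>\<^sub>0 nat\<close>.
\<close>

type_synonym 'v mpol = "('v \<Rightarrow>\<^sub>0 nat) \<Rightarrow>\<^sub>0 real"

definition mvar :: "'v \<Rightarrow> 'v mpol" where
  "mvar v = Poly_Mapping.single (Poly_Mapping.single v 1) 1"

definition mconst :: "real \<Rightarrow> 'v mpol" where
  "mconst r = Poly_Mapping.single 0 r"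

definition msubst :: "('v \<Rightarrow> 'w mpol) \<Rightarrow> 'v mpol \<Rightarrow> 'w mpol" where
  "msubst s p = (\<Sum>\<mu>\<in>Poly_Mapping.keys p. mconst (Poly_Mapping.lookup p \<mu>) *
     (\<Prod>v\<in>Poly_Mapping.keys \<mu>. s v ^ Poly_Mapping.lookup \<mu> v))"

text \<open>
  \<open>(g \<cdot> p)(x) = p(g\<^sup>-\<^sup>1 x)\<close>: the variable \<open>v\<close>, which is the \<open>v\<close>-th coordinate of the generic
  vector \<open>x\<close>, is replaced by the \<open>v\<close>-th coordinate of \<open>g\<^sup>-\<^sup>1 x\<close>.
\<close>

definition poly_act :: "real^'v^'v \<Rightarrow> 'v::finite mpol \<Rightarrow> 'v mpol" where
  "poly_act g p = msubst (\<lambda>v. \<Sum>w\<in>UNIV. mconst (matrix_inv g $ v $ w) * mvar w) p"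

text \<open>The variable \<open>x_f\<close> is the one indexed by the coordinates of \<open>f\<close>.\<close>

definition cwe :: "('m::finite \<Rightarrow> 'k::finite_field) \<Rightarrow> (bit^'n::finite) set \<Rightarrow> (bit^'m) mpol" where
  "cwe a C = (\<Sum>c\<in>ext_code C. \<Prod>f\<in>UNIV. mvar (coords a f) ^ card {i. c $ i = f})"

end

theory Submission
  imports Defs "HOL-Number_Theory.Residues"
begin

text \<open>
  Expanding coordinates over \<open>a\<close> turns \<open>fwe(C(m))\<close> into the indicator \<open>F\<close> of the words whose
  \<open>m\<close> binary rows all lie in \<open>C\<close>.  For \<open>e \<in> E(m)\<close> and \<open>c \<in> C\<close> let \<open>e\<^sup>c\<close> act as \<open>e\<close> on the tensor
  factors in the support of \<open>c\<close> and trivially on the others.  Self-duality of \<open>C\<close> makes \<open>F\<close>, up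
  to scalars, the only vector fixed by all \<open>e\<^sup>c\<close>: the diagonal \<open>e\<close> confine the support to that
  of \<open>F\<close> and the translations make the entries constant there.  An element \<open>g\<close> of the Clifford
  group permutes the operators \<open>e\<^sup>c\<close> by conjugation, so it maps \<open>F\<close> to a multiple of \<open>F\<close>.  The
  multiple is 1 because \<open>N\<close> is even and every orthogonal matrix fixes the nonnegative tensor
  \<open>(\<Sum>v. x\<^sub>v \<otimes> x\<^sub>v)\<close> raised to the power \<open>N/2\<close>, whose inner product with \<open>F\<close> is positive.
  Finally, \<open>cwe(C(m))\<close> is the image of \<open>fwe(C(m))\<close> under the equivariant map from tensors to
  polynomials that forgets the order of the factors.
\<close>

section \<open>Tensor powers\<close>

text \<open>Choice functions are written as vectors of type \<open>'a^'i\<close>, the index type of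
  tensor powers, so that products of tensors expand entrywise.\<close>

lemma prod_sum_vec:
  fixes f :: "'i::finite \<Rightarrow> 'a::finite \<Rightarrow> 'b::comm_semiring_1"
  shows "(\<Prod>i\<in>UNIV. \<Sum>x\<in>UNIV. f i x) = (\<Sum>w\<in>UNIV. \<Prod>i\<in>UNIV. f i (w $ i))"
proof -
  have "(\<Prod>i\<in>UNIV. \<Sum>x\<in>UNIV. f i x) = (\<Sum>h\<in>UNIV. \<Prod>i\<in>UNIV. f i (h i))"
    by (subst prod_sum_PiE) (auto simp: PiE_UNIV_domain)
  also have "\<dots> = (\<Sum>w\<in>UNIV. \<Prod>i\<in>UNIV. f i (w $ i))"
    by (rule sum.reindex_bij_witness[of _ vec_nth vec_lambda]) auto
  finally show ?thesis .
qed

lemma tensor_mat_mult: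
  "tensor_mat A ** tensor_mat B = tensor_mat (\<lambda>i. A i ** B i)"
  by (simp add: vec_eq_iff tensor_mat_def matrix_matrix_mult_def prod_sum_vec prod.distrib)

lemma tensor_mat_vec:
  "tensor_mat A *v tensor_vec x = tensor_vec (\<lambda>i. A i *v x i)"
  by (simp add: vec_eq_iff tensor_mat_def tensor_vec_def matrix_vector_mult_def prod_sum_vec prod.distrib)

lemma transpose_tensor_mat: "transpose (tensor_mat A) = tensor_mat (\<lambda>i. transpose (A i))"
  by (simp add: vec_eq_iff tensor_mat_def transpose_def)

lemma prod_of_bool: "finite A \<Longrightarrow> (\<Prod>i\<in>A. of_bool (P i)) = (of_bool (\<forall>i\<in>A. P i) :: 'a::comm_semiring_1)"
  by (induction A rule: finite_induct) auto

lemma axis_nth_of_bool: "axis v 1 $ w = (of_bool (w = v) :: 'a::semiring_1)"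
  by (simp add: axis_def)

lemma mat_1_nth_of_bool: "mat 1 $ v $ w = (of_bool (v = w) :: 'a::semiring_1)"
  by (simp add: mat_def)

lemma tensor_vec_axis: "tensor_vec (\<lambda>i. axis (v $ i) 1) = axis v 1"
  by (simp add: vec_eq_iff tensor_vec_def axis_nth_of_bool prod_of_bool)

lemma tensor_mat_1: "tensor_mat (\<lambda>_. mat 1) = mat 1"
  by (simp add: vec_eq_iff tensor_mat_def mat_1_nth_of_bool prod_of_bool)

lemma basis_vec_eq: "basis_vec v = axis v 1"
  by (simp add: basis_vec_def tensor_vec_axis)

lemma orthogonal_tensor_mat:
  assumes "\<And>i. orthogonal_matrix (A i)"
  shows "orthogonal_matrix (tensor_mat A)"
  using assms by (simp add: orthogonal_matrix_def transpose_tensor_mat tensor_mat_mult tensor_mat_1)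

section \<open>The group E(m) and its normalizer\<close>

text \<open>The nontrivial additive character of the field with two elements.\<close>

definition bit_sgn :: "bit \<Rightarrow> real" where
  "bit_sgn b = (if b = 0 then 1 else - 1)"

lemma bit_sgn_simps [simp]: "bit_sgn 0 = 1" "bit_sgn 1 = - 1"
  by (auto simp: bit_sgn_def)

lemma bit_sgn_add: "bit_sgn (x + y) = bit_sgn x * bit_sgn y"
  by (cases x; cases y) auto

lemma bit_sgn_sum: "bit_sgn (sum f A) = (\<Prod>i\<in>A. bit_sgn (f i))"
proof (induction A rule: infinite_finite_induct)
  case (insert x F)
  then show ?case by (simp only: sum.insert prod.insert bit_sgn_add not_False_eq_True)
qed simp_all

text \<open>This is \<open>(-1)^s * sigma2^z * sigma1^u\<close>; the sign is carried along because
  the generators anticommute.\<close>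

definition pauli :: "bit \<Rightarrow> bit \<Rightarrow> bit \<Rightarrow> real^bit^bit" where
  "pauli s z u = (\<chi> x y. bit_sgn (s + z * x) * of_bool (y = x + u))"

lemma UNIV_bit: "(UNIV :: bit set) = {0, 1}"
proof (intro equalityI subsetI)
  fix b :: bit
  show "b \<in> {0, 1}" by (cases b) simp_all
qed simp

text \<open>The term \<open>z' * u\<close> is the sign from moving \<open>sigma1^u\<close> past
  \<open>sigma2^z'\<close>.\<close>

lemma pauli_mult: "pauli s z u ** pauli s' z' u' = pauli (s + s' + z' * u) (z + z') (u + u')"
proof -
  have "bit_sgn (s + z * x) * of_bool (0 = x + u) * (bit_sgn (s' + z' * 0) * of_bool (y = 0 + u')) +
        bit_sgn (s + z * x) * of_bool (1 = x + u) * (bit_sgn (s' + z' * 1) * of_bool (y = 1 + u')) =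
        bit_sgn (s + s' + z' * u + (z + z') * x) * of_bool (y = x + (u + u'))" for x y
    by (cases x; cases y; cases u; cases u'; cases z; cases z'; cases s; cases s') simp_all
  then show ?thesis
    by (simp add: vec_eq_iff pauli_def matrix_matrix_mult_def UNIV_bit)
qed

lemma sigma1_eq: "sigma1 = pauli 0 0 1"
proof -
  have "(if x = y then 0 else 1) = bit_sgn (0 + 0 * x) * of_bool (y = x + 1)" for x y :: bit
    by (cases x; cases y) auto
  then show ?thesis by (simp add: vec_eq_iff sigma1_def pauli_def)
qed

lemma sigma2_eq: "sigma2 = pauli 0 1 0"
proof -
  have "(if x = y then (if x = 0 then 1 else -1) else 0) = bit_sgn (0 + 1 * x) * of_bool (y = x + 0)" for x y :: bit
    by (cases x; cases y) auto
  then show ?thesis by (simp add: vec_eq_iff sigma2_def pauli_def)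
qed

lemma mat_1_eq_pauli: "mat 1 = pauli 0 0 0"
  by (auto simp: vec_eq_iff pauli_def mat_1_nth_of_bool)

section \<open>The orthogonal group and the elements of E(1)\<close>

lemma carrier_orthogonal_grp: "A \<in> carrier orthogonal_grp \<longleftrightarrow> orthogonal_matrix A"
  by (simp add: orthogonal_grp_def)

lemma mult_orthogonal_grp: "A \<otimes>\<^bsub>orthogonal_grp\<^esub> B = A ** B"
  by (simp add: orthogonal_grp_def)

lemma one_orthogonal_grp: "\<one>\<^bsub>orthogonal_grp\<^esub> = mat 1"
  by (simp add: orthogonal_grp_def)

lemmas orthogonal_grp_simps = carrier_orthogonal_grp mult_orthogonal_grp one_orthogonal_grp

lemma group_orthogonal_grp: "group orthogonal_grp"
proof (rule groupI, goal_cases)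
  case (5 x)
  then show ?case
    unfolding orthogonal_grp_simps
    by (intro bexI[of _ "transpose x"]) (auto simp: orthogonal_grp_simps orthogonal_matrix_def)
qed (auto simp: orthogonal_grp_simps orthogonal_matrix_mul orthogonal_matrix_id matrix_mul_assoc)

lemma inv_orthogonal_grp:
  assumes "orthogonal_matrix A"
  shows "inv\<^bsub>orthogonal_grp\<^esub> A = transpose A"
  using assms
  by (intro group.inv_equality[OF group_orthogonal_grp])
     (auto simp: orthogonal_grp_simps orthogonal_matrix_def)

lemma orthogonal_pauli: "orthogonal_matrix (pauli s z u)"
proof -
  have "transpose (pauli s z u) = pauli (s + z * u) z u"
  proof -
    have "bit_sgn (s + z * y) * of_bool (x = y + u) = bit_sgn (s + z * u + z * x) * of_bool (y = x + u)" for x y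
      by (cases x; cases y; cases u; cases z; cases s) simp_all
    then show ?thesis by (simp add: vec_eq_iff transpose_def pauli_def)
  qed
  moreover have "s + z * u + s + z * u = 0" "s + (s + z * u) + z * u = 0" "z + z = 0" "u + u = 0"
    by (cases s; cases z; cases u; simp)+
  ultimately show ?thesis
    by (simp add: orthogonal_matrix_def pauli_mult mat_1_eq_pauli)
qed

text \<open>Both generators are involutions, so inverses add nothing new, and
  \<open>pauli_mult\<close> gives closure under products.\<close>

lemma E1_imp_pauli: "A \<in> E1 \<Longrightarrow> \<exists>s z u. A = pauli s z u"
  unfolding E1_def
proof (induction rule: generate.induct)
  case one
  then show ?case by (metis one_orthogonal_grp mat_1_eq_pauli)
next
  case (incl h)
  then show ?case using sigma1_eq sigma2_eq by blast
next
  case (inv h)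
  then have "h = pauli 0 0 1 \<or> h = pauli 0 1 0" by (auto simp: sigma1_eq sigma2_eq)
  then have "h ** h = mat 1" "orthogonal_matrix h"
    by (auto simp: pauli_mult mat_1_eq_pauli orthogonal_pauli)
  then have "inv\<^bsub>orthogonal_grp\<^esub> h = h"
    by (intro group.inv_equality[OF group_orthogonal_grp]) (auto simp: orthogonal_grp_simps)
  with \<open>h = _ \<or> _\<close> show ?case by metis
next
  case (eng h1 h2)
  then show ?case unfolding mult_orthogonal_grp by (metis pauli_mult)
qed

lemma pauli_in_E1: "pauli 0 z u \<in> E1"
proof -
  have g: "sigma1 \<in> E1" "sigma2 \<in> E1" "mat 1 \<in> E1"
    unfolding E1_def by (auto intro: generate.incl generate.one simp flip: one_orthogonal_grp)
  have "A ** B \<in> E1" if "A \<in> E1" "B \<in> E1" for A B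
    using generate.eng[of A orthogonal_grp _ B] that unfolding E1_def by (simp add: mult_orthogonal_grp)
  from this[OF g(2,1)] have "pauli 0 1 1 \<in> E1"
    by (simp add: sigma1_eq sigma2_eq pauli_mult)
  with g show ?thesis
    by (cases z; cases u) (simp_all add: sigma1_eq sigma2_eq mat_1_eq_pauli)
qed

text \<open>On functions of \<open>x\<close> this translates by \<open>u\<close>, then multiplies by
  the character of \<open>z\<close> and by \<open>s\<close>, into which the signs of all factors
  have merged.\<close>

definition paulis :: "real \<Rightarrow> bit^'m \<Rightarrow> bit^'m \<Rightarrow> real^(bit^'m::finite)^(bit^'m)" where
  "paulis s z u = (\<chi> x y. s * bit_sgn (\<Sum>i\<in>UNIV. z $ i * x $ i) * of_bool (y = x + u))"

lemma tensor_mat_pauli: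
  "tensor_mat (\<lambda>i. pauli (s i) (z i) (u i)) =
     paulis (bit_sgn (\<Sum>i\<in>UNIV. s i)) (\<chi> i. z i) (\<chi> i. u i)"
  unfolding vec_eq_iff tensor_mat_def pauli_def paulis_def vec_lambda_beta bit_sgn_add bit_sgn_sum
    prod.distrib prod_of_bool[OF finite] vector_add_component ball_UNIV
  by blast

lemma Em_imp_paulis:
  assumes "e \<in> Em"
  shows "\<exists>s z u. (s = 1 \<or> s = -1) \<and> e = paulis s z u"
proof -
  obtain A where e: "e = tensor_mat A" and "\<forall>i. A i \<in> E1"
    using assms by (auto simp: Em_def)
  then have "\<forall>i. \<exists>s z u. A i = pauli s z u" by (blast intro: E1_imp_pauli)
  then obtain s z u where "A = (\<lambda>i. pauli (s i) (z i) (u i))" by metis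
  with e show ?thesis
    by (metis tensor_mat_pauli bit_sgn_def)
qed

lemma paulis_in_Em: "paulis 1 z u \<in> Em"
proof -
  have "paulis 1 z u = tensor_mat (\<lambda>i. pauli 0 (z $ i) (u $ i))"
    by (simp add: tensor_mat_pauli)
  then show ?thesis by (auto simp: Em_def pauli_in_E1)
qed

lemma Em_subset_orthogonal: "Em \<subseteq> carrier orthogonal_grp"
  by (auto simp: Em_def orthogonal_grp_simps intro!: orthogonal_tensor_mat) (metis E1_imp_pauli orthogonal_pauli)

text \<open>The normalizer is a stabilizer under conjugation; the relation is phrased as an
  intertwining so that it lifts factor by factor to tensor powers.\<close>

lemma real_clifford_groupD:
  assumes "g \<in> real_clifford_group"
  shows "orthogonal_matrix g"
    and "e \<in> Em \<Longrightarrow> \<exists>e'\<in>Em. e ** g = g ** e'"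
proof -
  have g: "g \<in> carrier orthogonal_grp" "g <#\<^bsub>orthogonal_grp\<^esub> Em #>\<^bsub>orthogonal_grp\<^esub> inv\<^bsub>orthogonal_grp\<^esub> g = Em"
    using assms Em_subset_orthogonal unfolding real_clifford_group_def normalizer_def stabilizer_def by auto
  then show o: "orthogonal_matrix g" by (simp add: orthogonal_grp_simps)
  assume "e \<in> Em"
  then obtain e' where "e' \<in> Em" "e = g ** e' ** transpose g"
    using g(2) unfolding l_coset_def r_coset_def
    by (auto simp: mult_orthogonal_grp inv_orthogonal_grp[OF o])
  moreover then have "e ** g = g ** e'"
    using o by (metis orthogonal_matrix_def matrix_mul_assoc matrix_mul_rid)
  ultimately show "\<exists>e'\<in>Em. e ** g = g ** e'" by blast
qed

section \<open>The vectors fixed by the diagonal copies of E(m)\<close>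

definition code_op :: "real^'v^'v \<Rightarrow> bit^'n \<Rightarrow> real^('v::finite^'n::finite)^('v^'n)" where
  "code_op e c = tensor_mat (\<lambda>j. if c $ j = 1 then e else mat 1)"

lemma code_op_commute:
  assumes "e ** g = g ** e'"
  shows "code_op e c ** tensor_mat (\<lambda>_. g) = tensor_mat (\<lambda>_. g) ** code_op e' c"
  unfolding code_op_def tensor_mat_mult using assms by (intro arg_cong[of _ _ tensor_mat]) auto

text \<open>The rank-one array \<open>u \<otimes> c\<close>: adding it to a word translates by
  \<open>u\<close> exactly at the positions in the support of \<open>c\<close>.\<close>

definition bit_tensor :: "bit^'m \<Rightarrow> bit^'n \<Rightarrow> (bit^'m::finite)^'n::finite" where
  "bit_tensor u c = (\<chi> j i. u $ i * c $ j)"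

text \<open>Words over \<open>bit^'m\<close> are read as arrays with columns \<open>w $ j\<close>;
  by \<open>ext_code_eq\<close> this set is the extended code in coordinates.\<close>

definition row_space :: "(bit^'n::finite) set \<Rightarrow> ((bit^'m::finite)^'n) set" where
  "row_space C = {w. \<forall>i. (\<chi> j. w $ j $ i) \<in> C}"

text \<open>Each row of the matrix is supported at the single column
  \<open>w + bit_tensor u c\<close>. Every position in the support of \<open>c\<close> contributes
  one factor \<open>s\<close>, hence the weight as exponent.\<close>

lemma code_op_paulis_apply:
  fixes H :: "real^((bit^'m::finite)^'n::finite)"
  shows "(code_op (paulis s z u) c *v H) $ w =
     s ^ card {j. c $ j = 1} * bit_sgn (\<Sum>j\<in>UNIV. c $ j * (\<Sum>i\<in>UNIV. z $ i * w $ j $ i)) *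
       H $ (w + bit_tensor u c)"
proof -
  let ?S = "bit_sgn (\<Sum>j\<in>UNIV. c $ j * (\<Sum>i\<in>UNIV. z $ i * w $ j $ i))"
  have *: "(if c $ j = 1 then paulis s z u else mat 1) $ (w $ j) $ y =
      (if c $ j = 1 then s else 1) * bit_sgn (c $ j * (\<Sum>i\<in>UNIV. z $ i * w $ j $ i)) *
      of_bool (y = (w + bit_tensor u c) $ j)" for j y
  proof (cases "c $ j = 1")
    case False
    then have "(w + bit_tensor u c) $ j = w $ j" by (simp add: vec_eq_iff bit_tensor_def)
    with False show ?thesis by (auto simp: mat_def)
  next
    case True
    then have "(w + bit_tensor u c) $ j = w $ j + u" by (simp add: vec_eq_iff bit_tensor_def)
    with True show ?thesis by (auto simp: paulis_def)
  qed
  have op: "code_op (paulis s z u) c $ w $ v =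
      s ^ card {j. c $ j = 1} * ?S * of_bool (v = w + bit_tensor u c)" for v
  proof -
    have "(\<Prod>j\<in>UNIV. if c $ j = 1 then s else 1) = s ^ card {j. c $ j = 1}"
      by (subst prod.inter_filter[symmetric]) simp_all
    moreover have "(\<forall>j\<in>UNIV. v $ j = (w + bit_tensor u c) $ j) \<longleftrightarrow> v = w + bit_tensor u c"
      unfolding vec_eq_iff by blast
    ultimately show ?thesis
      unfolding code_op_def tensor_mat_def vec_lambda_beta * prod.distrib prod_of_bool[OF finite] bit_sgn_sum
      by simp
  qed
  have delta: "(\<Sum>v\<in>UNIV. t * of_bool (v = x) * H $ v) = t * H $ x" for t x
    by (simp add: of_bool_def if_distrib[of "\<lambda>b. _ * b"] if_distrib[of "\<lambda>b. b * _"] cong: if_cong)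
  show ?thesis
    unfolding matrix_vector_mult_def vec_lambda_beta op delta ..
qed

section \<open>Parity and closure properties of self-dual codes\<close>

lemma bit_mult_self: "(x::bit) * x = x" by (cases x) simp_all

lemma sum_bit_eq_card: "(\<Sum>j\<in>UNIV. c $ j) = of_nat (card {j. c $ j = (1::bit)})"
proof -
  have "(\<Sum>j\<in>UNIV. c $ j) = (\<Sum>j\<in>UNIV. if c $ j = 1 then 1 else 0)"
    by (intro sum.cong refl) simp
  then show ?thesis by (subst (asm) sum.inter_filter[symmetric]) simp_all
qed

lemma of_nat_bit_eq_0: "(of_nat n :: bit) = 0 \<longleftrightarrow> even n"
  by (induction n) simp_all

lemma self_dual_codeD:
  assumes "self_dual_code C" "v \<in> C" "c \<in> C"
  shows "(\<Sum>j\<in>UNIV. v $ j * c $ j) = 0"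
proof -
  have "v \<in> dual_code C" using assms by (simp add: self_dual_code_def)
  then show ?thesis using assms(3) unfolding dual_code_def by blast
qed

text \<open>Since \<open>x * x = x\<close> on bits, the pairing of \<open>c\<close> with itself is
  its weight modulo 2.\<close>

lemma self_dual_even_weight:
  assumes "self_dual_code C" "c \<in> C"
  shows "even (card {j. c $ j = 1})"
  using self_dual_codeD[OF assms(1,2,2)]
  unfolding bit_mult_self sum_bit_eq_card of_nat_bit_eq_0 .

text \<open>Every codeword has even weight, so the all-ones vector is orthogonal to \<open>C\<close> and hence
  itself a codeword.\<close>

lemma self_dual_even_length:
  fixes C :: "(bit^'n::finite) set"
  assumes "self_dual_code C"
  shows "even CARD('n)"
proof -
  have "(1 :: bit^'n) \<in> dual_code C"
    unfolding dual_code_def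
  proof (safe)
    fix c assume "c \<in> C"
    then show "(\<Sum>i\<in>UNIV. 1 $ i * c $ i) = 0"
      using self_dual_even_weight[OF assms] unfolding one_index mult_1 sum_bit_eq_card of_nat_bit_eq_0 by blast
  qed
  then have "1 \<in> C" using assms by (simp add: self_dual_code_def)
  from self_dual_even_weight[OF assms this] show ?thesis by simp
qed

lemma self_dual_code_add:
  assumes "self_dual_code C" "c \<in> C" "d \<in> C"
  shows "c + d \<in> C"
  using assms vec.subspace_add unfolding self_dual_code_def by blast

lemma self_dual_code_scale:
  assumes "self_dual_code C" "c \<in> C"
  shows "b *s c \<in> C"
  using assms vec.subspace_scale unfolding self_dual_code_def by blast

lemma bit_tensor_add_self: "bit_tensor u c + bit_tensor u c = 0"
proof -
  have "x + x = 0" for x :: bit by (cases x) simp_all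
  then show ?thesis unfolding vec_eq_iff by (simp only: vector_add_component zero_index simp_thms)
qed

lemma row_space_shift:
  assumes "self_dual_code C" "c \<in> C"
  shows "w + bit_tensor u c \<in> row_space C \<longleftrightarrow> w \<in> row_space C"
proof -
  have row: "(\<chi> j. (w + bit_tensor u c) $ j $ i) = (\<chi> j. w $ j $ i) + u $ i *s c" for w :: "(bit^'b)^'a" and i
    by (simp add: vec_eq_iff bit_tensor_def)
  have imp: "w + bit_tensor u c \<in> row_space C" if "w \<in> row_space C" for w
    using that assms unfolding row_space_def mem_Collect_eq row
    by (blast intro: self_dual_code_add self_dual_code_scale)
  have "(w + bit_tensor u c) + bit_tensor u c = w"
    by (simp only: add.assoc bit_tensor_add_self add_0_right)
  with imp show ?thesis by metis
qed

lemma zero_in_row_space: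
  assumes "self_dual_code C"
  shows "0 \<in> row_space C"
proof -
  have "0 \<in> C" using assms vec.subspace_0 unfolding self_dual_code_def by blast
  moreover have "(\<chi> j. (0 :: (bit^'b)^'a) $ j $ i) = 0" for i
    by (simp add: vec_eq_iff)
  ultimately show ?thesis by (simp add: row_space_def)
qed

definition code_vec :: "(bit^'n::finite) set \<Rightarrow> real^((bit^'m::finite)^'n)" where
  "code_vec C = (\<chi> w. of_bool (w \<in> row_space C))"

text \<open>Expresses the exponent of the sign through the pairings of the rows of \<open>w\<close>
  with \<open>c\<close>, which duality controls.\<close>

lemma swap_pairing:
  fixes w :: "(bit^'m::finite)^'n::finite"
  shows "(\<Sum>j\<in>UNIV. c $ j * (\<Sum>i\<in>UNIV. z $ i * w $ j $ i)) =
    (\<Sum>i\<in>UNIV. z $ i * (\<Sum>j\<in>UNIV. w $ j $ i * c $ j))"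
  unfolding sum_distrib_left by (subst sum.swap) (simp only: mult.assoc mult.commute mult.left_commute)

text \<open>Even weight cancels \<open>s\<close>, orthogonality of the rows to \<open>c\<close>
  makes the sign trivial on the support, and translation preserves the support.\<close>

lemma code_op_code_vec:
  assumes "self_dual_code C" "c \<in> C" "s = 1 \<or> s = -1"
  shows "code_op (paulis s z u) c *v code_vec C = code_vec C"
proof -
  have s: "s ^ card {j. c $ j = 1} = 1"
    using assms(3) self_dual_even_weight[OF assms(1,2)] by auto
  have "(\<Sum>j\<in>UNIV. c $ j * (\<Sum>i\<in>UNIV. z $ i * w $ j $ i)) = 0" if "w \<in> row_space C" for w :: "(bit^'b)^'a"
  proof -
    have "(\<Sum>j\<in>UNIV. w $ j $ i * c $ j) = 0" for i
      using self_dual_codeD[OF assms(1) _ assms(2), of "\<chi> j. w $ j $ i"] that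
      by (simp add: row_space_def)
    then show ?thesis unfolding swap_pairing by (simp only: mult_zero_right sum.neutral_const)
  qed
  then show ?thesis
    unfolding vec_eq_iff code_op_paulis_apply s
    by (auto simp: code_vec_def row_space_shift[OF assms(1,2)])
qed

lemma fixed_by_code_ops:
  fixes H :: "real^((bit^'m::finite)^'n::finite)"
  assumes C: "self_dual_code C"
    and fixed: "\<And>z u c. c \<in> C \<Longrightarrow> code_op (paulis 1 z u) c *v H = H"
  shows "H = H $ 0 *s code_vec C"
proof -
  have H: "H $ w = bit_sgn (\<Sum>i\<in>UNIV. z $ i * (\<Sum>j\<in>UNIV. w $ j $ i * c $ j)) * H $ (w + bit_tensor u c)"
    if "c \<in> C" for z u c w
    using arg_cong[OF fixed[OF that, of z u], of "\<lambda>x. x $ w"]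
    unfolding code_op_paulis_apply swap_pairing by simp
  have outside: "H $ w = 0" if w: "w \<notin> row_space C" for w
  proof -
    \<comment> \<open>A row outside \<open>C = dual_code C\<close> pairs to 1 with some
      \<open>c\<close>; taking \<open>z\<close> as the unit vector of that row and
      \<open>u = 0\<close> yields \<open>H $ w = - H $ w\<close>.\<close>
    obtain i where "(\<chi> j. w $ j $ i) \<notin> dual_code C"
      using w C by (auto simp: row_space_def self_dual_code_def)
    then obtain c where c: "c \<in> C" "(\<Sum>j\<in>UNIV. w $ j $ i * c $ j) \<noteq> 0"
      unfolding dual_code_def by auto
    have "(\<Sum>i'\<in>UNIV. axis i 1 $ i' * (\<Sum>j\<in>UNIV. w $ j $ i' * c $ j)) = (\<Sum>j\<in>UNIV. w $ j $ i * c $ j)"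
      by (simp only: axis_nth_of_bool of_bool_def if_distrib[where f="\<lambda>x. x * _"] mult_1 mult_zero_left
          sum.delta finite UNIV_I if_True)
    also have "\<dots> = 1" using c(2) by (metis bit_not_zero_iff)
    finally have "H $ w = - H $ (w + bit_tensor 0 c)"
      using H[OF c(1), of w "axis i 1" 0] by simp
    moreover have "w + bit_tensor 0 c = w" by (simp add: vec_eq_iff bit_tensor_def)
    ultimately show ?thesis by simp
  qed
  have shift: "H $ w = H $ (w + bit_tensor u c)" if "c \<in> C" for u c w
    using H[OF that, of w 0 u] by simp
  \<comment> \<open>The rows of \<open>w\<close> are filled in one at a time, starting from 0;
    inserting row \<open>k\<close>, itself a codeword, is a translation by a
    \<open>bit_tensor\<close>.\<close>
  have inside: "H $ (\<chi> j i. if i \<in> I then w $ j $ i else 0) = H $ 0"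
    if w: "w \<in> row_space C" and "finite I" for w I
    using that(2)
  proof (induction I rule: finite_induct)
    case empty
    then show ?case by (simp flip: zero_vec_def)
  next
    case (insert k I)
    let ?c = "\<chi> j. w $ j $ k"
    let ?w = "\<lambda>I. (\<chi> j i. if i \<in> I then w $ j $ i else 0) :: (bit^'m)^'n"
    have *: "?w (insert k I) = ?w I + bit_tensor (axis k 1) ?c"
      using insert.hyps by (auto simp: vec_eq_iff bit_tensor_def axis_def)
    have c: "?c \<in> C" using w by (simp add: row_space_def)
    show ?case unfolding * shift[OF c, symmetric] by (rule insert.IH)
  qed
  have "H $ w = H $ 0" if "w \<in> row_space C" for w
    using inside[OF that, of UNIV] by simp
  with outside show ?thesis
    by (auto simp: vec_eq_iff code_vec_def)
qed

section \<open>Invariance of the indicator of the extended code\<close>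

text \<open>A bijection between two halves is a perfect matching; it supplies the pairs of
  coordinates for the invariant tensor.\<close>

lemma finite_even_split:
  assumes "finite S" "even (card S)"
  shows "\<exists>A B h. A \<union> B = S \<and> A \<inter> B = {} \<and> bij_betw h A B"
proof -
  from assms(2) obtain k where k: "card S = 2 * k" by (auto elim: evenE)
  then obtain A where A: "A \<subseteq> S" "card A = k"
    using obtain_subset_with_card_n[of k S] by auto
  then have "card A = card (S - A)" "finite A" "finite (S - A)"
    using k assms(1) by (auto simp: card_Diff_subset finite_subset)
  then obtain h where "bij_betw h A (S - A)"
    using finite_same_card_bij by blast
  with A(1) show ?thesis by (intro exI[of _ A] exI[of _ "S - A"] exI[of _ h]) auto
qed

text \<open>The witness is the tensor product, over \<open>N/2\<close> disjoint pairs of coordinates, of the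
  tensors \<open>\<Sum>x. e\<^sub>x \<otimes> e\<^sub>x\<close>, which orthogonal matrices fix.\<close>

lemma orthogonal_tensor_power_invariant:
  assumes "even CARD('n::finite)"
  shows "\<exists>D :: real^('v::finite^'n).
    (\<forall>g. orthogonal_matrix g \<longrightarrow> tensor_mat (\<lambda>_. g) *v D = D) \<and>
    (\<forall>w. 0 \<le> D $ w) \<and> (\<forall>x. 0 < D $ (\<chi> j. x))"
proof -
  obtain A B and h :: "'n \<Rightarrow> 'n" where AB: "A \<union> B = UNIV" "A \<inter> B = {}" and h: "bij_betw h A B"
    using finite_even_split[of "UNIV :: 'n set"] assms by auto
  \<comment> \<open>\<open>p\<close> sends a coordinate to the representative in \<open>A\<close> of
    its pair.\<close>
  define p where "p j = (if j \<in> A then j else inv_into A h j)" for j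
  have p: "p j = j" "p (h j) = j" if "j \<in> A" for j
    using that h AB unfolding p_def bij_betw_def by auto
  define D :: "real^('v^'n)" where
    "D = (\<Sum>f\<in>PiE A (\<lambda>_. UNIV). tensor_vec (\<lambda>j. axis (f (p j)) 1))"
  \<comment> \<open>The pair \<open>i\<close>, \<open>h i\<close> contributes an entry of
    \<open>g ** transpose g\<close>, so the result does not depend on \<open>g\<close>; the identity
    matrix then gives \<open>D\<close> itself.\<close>
  have D: "(tensor_mat (\<lambda>_. g) *v D) $ v = (\<Prod>i\<in>A. of_bool (v $ i = v $ h i))"
    if g: "orthogonal_matrix g" for g v
  proof -
    have "(tensor_mat (\<lambda>_. g) *v D) $ v = (\<Sum>f\<in>PiE A (\<lambda>_. UNIV). \<Prod>j\<in>UNIV. g $ (v $ j) $ f (p j))"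
      unfolding D_def vec.sum tensor_mat_vec sum_component
      by (simp add: tensor_vec_def column_def matrix_vector_mult_basis)
    also have "\<dots> = (\<Sum>f\<in>PiE A (\<lambda>_. UNIV). \<Prod>i\<in>A. g $ (v $ i) $ f i * g $ (v $ h i) $ f i)"
    proof (intro sum.cong refl)
      fix f
      have "(\<Prod>j\<in>UNIV. g $ (v $ j) $ f (p j)) = (\<Prod>j\<in>A. g $ (v $ j) $ f (p j)) * (\<Prod>j\<in>B. g $ (v $ j) $ f (p j))"
        using prod.union_disjoint[of A B] AB by simp
      also have "(\<Prod>j\<in>B. g $ (v $ j) $ f (p j)) = (\<Prod>i\<in>A. g $ (v $ h i) $ f (p (h i)))"
        by (rule prod.reindex_bij_betw[OF h, symmetric])
      finally show "(\<Prod>j\<in>UNIV. g $ (v $ j) $ f (p j)) = (\<Prod>i\<in>A. g $ (v $ i) $ f i * g $ (v $ h i) $ f i)"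
        by (simp add: p prod.distrib)
    qed
    also have "\<dots> = (\<Prod>i\<in>A. \<Sum>x\<in>UNIV. g $ (v $ i) $ x * g $ (v $ h i) $ x)"
      by (subst prod_sum_PiE) auto
    also have "\<dots> = (\<Prod>i\<in>A. (g ** transpose g) $ (v $ i) $ (v $ h i))"
      by (simp add: matrix_matrix_mult_def transpose_def)
    also have "\<dots> = (\<Prod>i\<in>A. of_bool (v $ i = v $ h i))"
      using g by (simp add: orthogonal_matrix_def mat_1_nth_of_bool)
    finally show ?thesis .
  qed
  have D1: "D $ v = (\<Prod>i\<in>A. of_bool (v $ i = v $ h i))" for v
    using D[OF orthogonal_matrix_id, of v] by (simp add: tensor_mat_1)
  have "tensor_mat (\<lambda>_. g) *v D = D" if "orthogonal_matrix g" for g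
    unfolding vec_eq_iff using D[OF that] D1 by metis
  moreover have "0 \<le> D $ w" for w
    unfolding D1 by (intro prod_nonneg) simp
  moreover have "0 < D $ (\<chi> j. x)" for x
    unfolding D1 by simp
  ultimately show ?thesis by blast
qed

lemma clifford_fixes_code_vec:
  fixes C :: "(bit^'n::finite) set"
    and g :: "real^(bit^'m::finite)^(bit^'m)"
  assumes C: "self_dual_code C" and g: "g \<in> real_clifford_group"
  shows "tensor_mat (\<lambda>_::'n. g) *v code_vec C = code_vec C"
proof -
  let ?G = "tensor_mat (\<lambda>_::'n. g)" and ?F = "code_vec C :: real^((bit^'m)^'n)"
  define H where "H = ?G *v ?F"
  \<comment> \<open>Conjugation may give \<open>e'\<close> the sign -1, which
    \<open>code_op_code_vec\<close> absorbs.\<close>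
  have "code_op (paulis 1 z u) c *v H = H" if c: "c \<in> C" for z u c
  proof -
    obtain e' where "e' \<in> Em" and e': "paulis 1 z u ** g = g ** e'"
      using real_clifford_groupD(2)[OF g paulis_in_Em] by blast
    then have "code_op e' c *v ?F = ?F"
      using Em_imp_paulis code_op_code_vec[OF C c] by blast
    then show ?thesis
      unfolding H_def matrix_vector_mul_assoc code_op_commute[OF e']
      by (simp flip: matrix_vector_mul_assoc)
  qed
  then have H: "H = H $ 0 *s ?F" by (rule fixed_by_code_ops[OF C])
  have o: "orthogonal_matrix (transpose g)"
    using real_clifford_groupD(1)[OF g] by (simp add: orthogonal_matrix_def)
  obtain D :: "real^((bit^'m)^'n)" where
    D: "\<And>g. orthogonal_matrix g \<Longrightarrow> tensor_mat (\<lambda>_. g) *v D = D" "\<And>w. 0 \<le> D $ w" "\<And>x. 0 < D $ (\<chi> j. x)"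
    using orthogonal_tensor_power_invariant[where 'n='n and 'v="bit^'m", OF self_dual_even_length[OF C]]
    by blast
  have F0: "?F $ 0 = 1"
    by (simp add: code_vec_def zero_in_row_space[OF C])
  have "D $ 0 > 0" using D(3)[of 0] by (simp flip: zero_vec_def)
  then have "0 < (\<Sum>w\<in>UNIV. ?F $ w * D $ w)"
    by (intro sum_pos2[of _ 0]) (auto simp: zero_in_row_space[OF C] D(2) code_vec_def)
  then have pos: "?F \<bullet> D > 0" by (simp add: inner_vec_def)
  \<comment> \<open>Moving \<open>?G\<close> across the inner product gives its transpose, which
    also fixes \<open>D\<close>; positivity of the pairing then forces the scalar
    \<open>H $ 0\<close> to be 1.\<close>
  have "H $ 0 * (?F \<bullet> D) = H \<bullet> D"
    by (subst (2) H) (simp add: inner_vec_def sum_distrib_left mult.assoc)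
  also have "\<dots> = (D v* ?G) \<bullet> ?F"
    unfolding H_def dot_lmul_matrix by (rule inner_commute)
  also have "D v* ?G = D"
    unfolding transpose_matrix_vector[symmetric] transpose_tensor_mat by (rule D(1)[OF o])
  also have "D \<bullet> ?F = ?F \<bullet> D"
    by (rule inner_commute)
  finally have "H $ 0 = 1" using pos by simp
  with H show ?thesis by (simp add: H_def)
qed

section \<open>The full weight enumerator\<close>

lemma CHAR_eq_2:
  assumes "CARD('k::finite_field) = 2 ^ n"
  shows "CHAR('k) = 2"
proof -
  have "prime CHAR('k)" using finite_imp_CHAR_pos[where 'a='k] by (intro prime_CHAR_semidom) auto
  moreover have "CHAR('k) dvd 2 ^ n" using CHAR_dvd_CARD[where 'a='k] assms by simp
  ultimately show ?thesis by (metis prime_dvd_power primes_dvd_imp_eq two_is_prime_nat)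
qed

lemma of_bit_hom:
  assumes "CHAR('k::field) = 2"
  shows "(of_bit (x + y) :: 'k) = of_bit x + of_bit y" "(of_bit (x * y) :: 'k) = of_bit x * of_bit y"
proof -
  have "(1 + 1 :: 'k) = 0" using of_nat_CHAR[where 'a='k] assms by simp
  then show "(of_bit (x + y) :: 'k) = of_bit x + of_bit y" by (cases x; cases y) simp_all
  show "(of_bit (x * y) :: 'k) = of_bit x * of_bit y" by (cases x; cases y) simp_all
qed

lemma vector_space_F2_scale:
  assumes "CHAR('k::field) = 2"
  shows "vector_space (F2_scale :: bit \<Rightarrow> 'k \<Rightarrow> 'k)"
  by unfold_locales (auto simp only: F2_scale_def of_bit_hom[OF assms] distrib_left distrib_right mult.assoc
      odd_one of_bool_eq mult_1 not_False_eq_True)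

text \<open>The explicit inverse of \<open>coords a\<close>, which is only a definite
  description.\<close>

definition decode :: "('m::finite \<Rightarrow> 'k::field) \<Rightarrow> bit^'m \<Rightarrow> 'k" where
  "decode a v = (\<Sum>i\<in>UNIV. F2_scale (v $ i) (a i))"

lemma bij_decode:
  assumes ch: "CHAR('k::field) = 2" and a: "F2_basis (a :: 'm::finite \<Rightarrow> 'k)"
  shows "bij (decode a)"
proof -
  interpret F2: vector_space "F2_scale :: bit \<Rightarrow> 'k \<Rightarrow> 'k"
    by (rule vector_space_F2_scale[OF ch])
  have "inj a" and ind: "F2.independent (range a)" and span: "F2.span (range a) = UNIV"
    using a by (auto simp: F2_basis_def)
  \<comment> \<open>Independence and span concern the set \<open>range a\<close>; injectivity of
    \<open>a\<close> turns sums over it into sums over indices.\<close>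
  have reindex: "(\<Sum>y\<in>range a. F2_scale (u y) y) = decode a (\<chi> i. u (a i))" for u
    unfolding decode_def by (subst sum.reindex[OF \<open>inj a\<close>]) simp
  have diff: "decode a (v - w) = decode a v - decode a w" for v w
    unfolding decode_def by (simp only: vector_minus_component F2.scale_left_diff_distrib sum_subtractf)
  have "v = 0" if "decode a v = 0" for v
  proof -
    have v: "(\<chi> i. (v $ inv_into UNIV a (a i))) = v" by (simp add: vec_eq_iff \<open>inj a\<close>)
    have "v $ inv_into UNIV a y = 0" if "y \<in> range a" for y
      using F2.independentD[OF ind _ _ _ that, of "\<lambda>y. v $ inv_into UNIV a y"] \<open>decode a v = 0\<close>
      by (simp add: reindex v)
    then show ?thesis using \<open>inj a\<close> by (simp add: vec_eq_iff) (metis inv_f_f rangeI)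
  qed
  then have "inj (decode a)"
    by (metis diff eq_iff_diff_eq_0 injI)
  moreover have "range (\<lambda>u. decode a (\<chi> i. u (a i))) = UNIV"
    using span F2.span_finite[of "range a"] by (simp add: reindex)
  then have "surj (decode a)" by blast
  ultimately show ?thesis by (simp add: bij_def)
qed

lemma coords_decode:
  assumes "CHAR('k::field) = 2" "F2_basis (a :: 'm::finite \<Rightarrow> 'k)"
  shows "coords a (decode a v) = v"
  unfolding coords_def decode_def[symmetric]
  using bij_decode[OF assms] by (auto simp: bij_def inj_def)

text \<open>Writing a scalar as \<open>decode a u\<close> turns a multiple of a codeword
  \<open>c\<close> into the array \<open>bit_tensor u c\<close>. Conversely, an array decodes to the
  combination of its rows with coefficients \<open>a i\<close>.\<close>

lemma ext_code_eq:
  fixes a :: "'m::finite \<Rightarrow> 'k::field" and C :: "(bit^'n::finite) set"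
  assumes ch: "CHAR('k) = 2" and a: "F2_basis a" and C: "self_dual_code C"
  shows "ext_code C = (\<lambda>w. \<chi> j. decode a (w $ j)) ` row_space C"
proof (intro equalityI subsetI)
  fix y :: "'k^'n" assume "y \<in> ext_code C"
  then show "y \<in> (\<lambda>w. \<chi> j. decode a (w $ j)) ` row_space C"
    unfolding ext_code_def
  proof (induction rule: vec.span_induct_alt)
    case base
    show ?case
      by (rule image_eqI[OF _ zero_in_row_space[OF C]]) (simp add: vec_eq_iff decode_def F2_scale_def)
  next
    case (step k x y)
    then obtain c w where c: "c \<in> C" "x = (\<chi> i. of_bit (c $ i))" and w: "w \<in> row_space C" "y = (\<chi> j. decode a (w $ j))"
      by auto
    obtain u where k: "k = decode a u" using bij_decode[OF ch a] by (metis bij_pointE)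
    have "k * of_bit (c $ j) + decode a (w $ j) = decode a ((w + bit_tensor u c) $ j)" for j
      unfolding k decode_def F2_scale_def bit_tensor_def vector_add_component vec_lambda_beta
        of_bit_hom[OF ch] distrib_right sum.distrib sum_distrib_right
      by (simp only: mult_ac add_ac)
    then have "k *s x + y = (\<chi> j. decode a ((w + bit_tensor u c) $ j))"
      by (simp add: vec_eq_iff c w)
    moreover have "w + bit_tensor u c \<in> row_space C"
      using row_space_shift[OF C c(1)] w(1) by blast
    ultimately show ?case by (rule image_eqI)
  qed
next
  fix y assume "y \<in> (\<lambda>w. \<chi> j. decode a (w $ j)) ` row_space C"
  then obtain w where w: "w \<in> row_space C" "y = (\<chi> j. decode a (w $ j))" by auto
  have "y = (\<Sum>i\<in>UNIV. a i *s (\<chi> j. of_bit ((\<chi> j. w $ j $ i) $ j)))"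
    unfolding w decode_def F2_scale_def vec_eq_iff sum_component vec_lambda_beta vector_smult_component
    by (simp only: mult.commute simp_thms)
  also have "\<dots> \<in> ext_code C"
    unfolding ext_code_def using w(1)
    by (intro vec.span_sum vec.span_scale vec.span_base imageI) (simp add: row_space_def)
  finally show "y \<in> ext_code C" .
qed

text \<open>Distinct codewords contribute distinct standard basis vectors, so the sum is an
  indicator.\<close>

lemma fwe_eq_code_vec:
  fixes a :: "'m::finite \<Rightarrow> 'k::field" and C :: "(bit^'n::finite) set"
  assumes ch: "CHAR('k) = 2" and a: "F2_basis a" and C: "self_dual_code C"
  shows "fwe a C = code_vec C"
proof -
  have "inj_on (\<lambda>w. (\<chi> j. decode a (w $ j)) :: 'k^'n) (row_space C)"
  proof (rule inj_onI)
    fix v w assume "(\<chi> j. decode a (v $ j)) = ((\<chi> j. decode a (w $ j)) :: 'k^'n)"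
    then have "decode a (v $ j) = decode a (w $ j)" for j
      unfolding vec_eq_iff vec_lambda_beta by blast
    then show "v = w"
      using bij_is_inj[OF bij_decode[OF ch a]] unfolding vec_eq_iff[of v w] by (blast dest: injD)
  qed
  then have "fwe a C = (\<Sum>w\<in>row_space C. axis w 1)"
    unfolding fwe_def ext_code_eq[OF assms]
    by (subst sum.reindex) (simp_all add: coords_decode[OF ch a] basis_vec_eq tensor_vec_axis)
  also have "\<dots> = code_vec C"
  proof (rule vec_eq_iff[THEN iffD2], rule allI)
    fix v
    show "(\<Sum>w\<in>row_space C. axis w 1) $ v = (code_vec C :: real^((bit^'m)^'n)) $ v"
      unfolding code_vec_def sum_component axis_nth_of_bool of_bool_def vec_lambda_beta
      by (rule sum.delta'[OF finite])
  qed
  finally show ?thesis .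
qed

section \<open>The complete weight enumerator\<close>

lemma mconst_add: "mconst (x + y) = mconst x + mconst y"
  by (simp add: mconst_def single_add)

lemma mconst_0: "mconst 0 = 0"
  by (simp add: mconst_def)

lemma mconst_1: "mconst 1 = 1"
  by (simp add: mconst_def)

lemma mconst_mult: "mconst (x * y) = mconst x * mconst y"
  by (simp add: mconst_def mult_single)

lemma mconst_sum: "mconst (sum f A) = (\<Sum>x\<in>A. mconst (f x))"
  by (induction A rule: infinite_finite_induct) (simp_all add: mconst_0 mconst_add)

lemma mconst_prod: "mconst (prod f A) = (\<Prod>x\<in>A. mconst (f x))"
  by (induction A rule: infinite_finite_induct) (simp_all add: mconst_1 mconst_mult)

text \<open>A common finite index set lets several polynomials be treated term by term; the added
  terms have coefficient 0.\<close>

lemma msubst_eq_superset: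
  assumes "finite K" "Poly_Mapping.keys p \<subseteq> K"
  shows "msubst s p = (\<Sum>\<mu>\<in>K. mconst (Poly_Mapping.lookup p \<mu>) *
    (\<Prod>v\<in>Poly_Mapping.keys \<mu>. s v ^ Poly_Mapping.lookup \<mu> v))"
  unfolding msubst_def using assms
  by (intro sum.mono_neutral_left) (auto simp: in_keys_iff mconst_0)

lemma msubst_add: "msubst s (p + q) = msubst s p + msubst s q"
proof -
  let ?K = "Poly_Mapping.keys p \<union> Poly_Mapping.keys q"
  have "Poly_Mapping.keys (p + q) \<subseteq> ?K" by (rule keys_add)
  then show ?thesis
    by (simp add: msubst_eq_superset[of ?K] lookup_add mconst_add distrib_right sum.distrib)
qed

lemma msubst_sum: "msubst s (sum f A) = (\<Sum>x\<in>A. msubst s (f x))"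
  by (induction A rule: infinite_finite_induct) (simp_all add: msubst_add, simp_all add: msubst_def)

lemma msubst_single:
  fixes \<mu> :: "'v::finite \<Rightarrow>\<^sub>0 nat"
  shows "msubst s (Poly_Mapping.single \<mu> r) = mconst r * (\<Prod>v\<in>UNIV. s v ^ Poly_Mapping.lookup \<mu> v)"
proof -
  have "msubst s (Poly_Mapping.single \<mu> r) =
      mconst r * (\<Prod>v\<in>Poly_Mapping.keys \<mu>. s v ^ Poly_Mapping.lookup \<mu> v)"
    by (subst msubst_eq_superset[of "{\<mu>}"]) auto
  also have "(\<Prod>v\<in>Poly_Mapping.keys \<mu>. s v ^ Poly_Mapping.lookup \<mu> v) =
      (\<Prod>v\<in>UNIV. s v ^ Poly_Mapping.lookup \<mu> v)"
    by (intro prod.mono_neutral_left) (auto simp: in_keys_iff)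
  finally show ?thesis .
qed

lemma prod_mvar:
  "finite A \<Longrightarrow> (\<Prod>j\<in>A. mvar (w j)) = Poly_Mapping.single (\<Sum>j\<in>A. Poly_Mapping.single (w j) 1) 1"
  by (induction A rule: finite_induct) (simp_all add: mvar_def mult_single)

text \<open>The exponent of \<open>v\<close> counts the positions \<open>j\<close> with
  \<open>w j = v\<close>; splitting the powers regroups the product by position.\<close>

lemma msubst_monomial:
  fixes w :: "'n::finite \<Rightarrow> 'v::finite"
  shows "msubst s (mconst r * (\<Prod>j\<in>UNIV. mvar (w j))) = mconst r * (\<Prod>j\<in>UNIV. s (w j))"
proof -
  have "(\<Prod>v\<in>UNIV. s v ^ Poly_Mapping.lookup (\<Sum>j\<in>UNIV. Poly_Mapping.single (w j) 1) v) =
      (\<Prod>j\<in>UNIV. \<Prod>v\<in>UNIV. s v ^ Poly_Mapping.lookup (Poly_Mapping.single (w j) 1) v)"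
    unfolding lookup_sum power_sum by (rule prod.swap)
  also have "\<dots> = (\<Prod>j\<in>UNIV. \<Prod>v\<in>UNIV. if v = w j then s v else 1)"
    by (intro prod.cong refl) (simp add: lookup_single when_def)
  also have "\<dots> = (\<Prod>j\<in>UNIV. s (w j))"
    by simp
  finally show ?thesis
    by (simp add: prod_mvar mconst_def mult_single msubst_single del: One_nat_def)
qed

text \<open>The projection from the tensor power to the symmetric power, seen as homogeneous
  polynomials.\<close>

definition tensor_poly :: "real^('v::finite^'n::finite) \<Rightarrow> 'v mpol" where
  "tensor_poly t = (\<Sum>w\<in>UNIV. mconst (t $ w) * (\<Prod>j\<in>UNIV. mvar (w $ j)))"

lemma tensor_poly_sum: "tensor_poly (sum f A) = (\<Sum>x\<in>A. tensor_poly (f x))"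
  unfolding tensor_poly_def sum_component mconst_sum sum_distrib_right by (rule sum.swap)

lemma tensor_poly_axis: "tensor_poly (axis w 1) = (\<Prod>j\<in>UNIV. mvar (w $ j))"
proof -
  have "tensor_poly (axis w 1) = (\<Sum>v\<in>UNIV. if v = w then \<Prod>j\<in>UNIV. mvar (v $ j) else 0)"
    unfolding tensor_poly_def by (intro sum.cong refl) (simp add: axis_nth_of_bool mconst_0 mconst_1)
  then show ?thesis by simp
qed

lemma matrix_inv_orthogonal:
  assumes "orthogonal_matrix (g :: real^'v^'v)"
  shows "matrix_inv g = transpose g"
  unfolding matrix_inv_def
proof (rule some_equality)
  show "g ** transpose g = mat 1 \<and> transpose g ** g = mat 1"
    using assms by (simp add: orthogonal_matrix_def)
  show "h = transpose g" if "g ** h = mat 1 \<and> h ** g = mat 1" for h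
    using that assms by (metis matrix_mul_assoc matrix_mul_lid matrix_mul_rid orthogonal_matrix_def)
qed

text \<open>Substituting the inverse of \<open>g\<close> in the variables acts on coefficients by
  the inverse transpose, which for orthogonal \<open>g\<close> is \<open>g\<close> again.\<close>

lemma poly_act_tensor_poly:
  fixes t :: "real^('v::finite^'n::finite)"
  assumes "orthogonal_matrix g"
  shows "poly_act g (tensor_poly t) = tensor_poly (tensor_mat (\<lambda>_. g) *v t)"
proof -
  let ?m = "\<lambda>w::'v^'n. \<Prod>j\<in>UNIV. mvar (w $ j)"
  have "poly_act g (tensor_poly t) =
      (\<Sum>w\<in>UNIV. mconst (t $ w) * (\<Prod>j\<in>UNIV. \<Sum>x\<in>UNIV. mconst (g $ x $ (w $ j)) * mvar x))"
    unfolding poly_act_def tensor_poly_def msubst_sum msubst_monomial matrix_inv_orthogonal[OF assms]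
    by (simp add: transpose_def)
  also have "\<dots> = (\<Sum>w\<in>UNIV. \<Sum>v\<in>UNIV. mconst (t $ w) * mconst (tensor_mat (\<lambda>_. g) $ v $ w) * ?m v)"
    unfolding prod_sum_vec prod.distrib tensor_mat_def vec_lambda_beta mconst_prod sum_distrib_left mult.assoc ..
  also have "\<dots> = (\<Sum>v\<in>UNIV. \<Sum>w\<in>UNIV. mconst (t $ w) * mconst (tensor_mat (\<lambda>_. g) $ v $ w) * ?m v)"
    by (rule sum.swap)
  also have "\<dots> = tensor_poly (tensor_mat (\<lambda>_. g) *v t)"
    unfolding tensor_poly_def matrix_vector_mult_def vec_lambda_beta mconst_sum mconst_mult sum_distrib_right
    by (simp add: mult_ac)
  finally show ?thesis .
qed

text \<open>Grouping the positions of a codeword by letter turns the product over positions into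
  powers.\<close>

lemma cwe_eq_tensor_poly:
  fixes a :: "'m::finite \<Rightarrow> 'k::finite_field" and C :: "(bit^'n::finite) set"
  shows "cwe a C = tensor_poly (fwe a C)"
proof -
  have "(\<Prod>f\<in>UNIV. mvar (coords a f) ^ card {i. c $ i = f}) = (\<Prod>i\<in>UNIV. mvar (coords a (c $ i)))"
    for c :: "'k^'n"
  proof -
    have "(\<Prod>i\<in>UNIV. mvar (coords a (c $ i))) =
        (\<Prod>f\<in>UNIV. \<Prod>i | i \<in> UNIV \<and> c $ i = f. mvar (coords a (c $ i)))"
      by (rule prod.group[symmetric]) auto
    also have "\<dots> = (\<Prod>f\<in>UNIV. mvar (coords a f) ^ card {i. c $ i = f})"
      by (intro prod.cong refl) simp
    finally show ?thesis ..
  qed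
  moreover have "tensor_vec (\<lambda>i. axis (coords a (c $ i)) 1) = axis (\<chi> i. coords a (c $ i)) 1"
    for c :: "'k^'n"
    using tensor_vec_axis[of "\<chi> i. coords a (c $ i)"] by simp
  ultimately show ?thesis
    by (simp add: cwe_def fwe_def basis_vec_eq tensor_poly_sum tensor_poly_axis)
qed

theorem theorem3p5:
  fixes a :: "'m::finite \<Rightarrow> 'k::finite_field"
    and C :: "(bit^'n::finite) set"
  assumes "CARD('k) = 2 ^ CARD('m)"
    and "F2_basis a"
    and "self_dual_code C"
  shows "(\<forall>g\<in>real_clifford_group. tensor_mat (\<lambda>_::'n. g) *v fwe a C = fwe a C) \<and>
         (\<forall>g\<in>real_clifford_group. poly_act g (cwe a C) = cwe a C)"
proof -
  have "tensor_mat (\<lambda>_::'n. g) *v fwe a C = fwe a C" if "g \<in> real_clifford_group" for g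
    unfolding fwe_eq_code_vec[OF CHAR_eq_2[OF assms(1)] assms(2,3)]
    by (rule clifford_fixes_code_vec[OF assms(3) that])
  moreover from this have "poly_act g (cwe a C) = cwe a C" if "g \<in> real_clifford_group" for g
    using that
    unfolding cwe_eq_tensor_poly poly_act_tensor_poly[OF real_clifford_groupD(1)[OF that]] by simp
  ultimately show ?thesis by blast
qed

end
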